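(* Let $f:\mathbb{R}^d\to\mathbb{R}$ be differentiable, convex and symmetrically $(L_0,L_1)$-smooth with $L_0>0$, $L_1\ge0$, and let $x^*\in\arg\min_{x\in\mathbb{R}^d} f(x)$. Let $\nu$ be the real number with $\nu=e^{-\nu}$ and let $0<\eta\le\frac{\nu}{2}$. Let $x^0\in\mathbb{R}^d$ and consider the iterates of the $(L_0,L_1)$-Similar Triangles Method with stepsize parameter $\eta$ and with $$G_1=L_0+L_1\|\nabla f(x^0)\|,\qquad G_{k+1}=\max\{G_k,\ L_0+L_1\|\nabla f(x^{k+1})\|\},\quad k\ge1.$$ Then for all $N\ge1$ $$f(y^N)-f(x^* )\le\frac{2L_0\big(1+L_1\|x^0-x^*\|\exp(L_1\|x^0-x^*\|)\big)\|x^0-x^*\|^2}{\eta N(N+3)}.$$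
   Context: $\|\cdot\|$ is the Euclidean norm. A differentiable $f:\mathbb{R}^d\to\mathbb{R}$ is convex if $f(y)\ge f(x)+\langle\nabla f(x),y-x\rangle$ for all $x,y$. It is symmetrically $(L_0,L_1)$-smooth if for all $x,y\in\mathbb{R}^d$ $$\|\nabla f(x)-\nabla f(y)\|\le\Big(L_0+L_1\sup_{u\in[x,y]}\|\nabla f(u)\|\Big)\|x-y\|,$$ where $[x,y]$ is the line segment between $x$ and $y$. The $(L_0,L_1)$-Similar Triangles Method ($(L_0,L_1)$-STM): set $y^0=z^0=x^0$, $A_0=0$, and for $k=0,1,2,\ldots$ $$\alpha_{k+1}=\frac{\eta(k+2)}{2},\quad A_{k+1}=A_k+\alpha_{k+1},\quad x^{k+1}=\frac{A_ky^k+\alpha_{k+1}z^k}{A_{k+1}},$$ $$z^{k+1}=z^k-\frac{\alpha_{k+1}}{G_{k+1}}\nabla f(x^{k+1}),\quad y^{k+1}=\frac{A_ky^k+\alpha_{k+1}z^{k+1}}{A_{k+1}},$$ where $G_{k+1}\ge L_0+L_1\|\nabla f(x^{k+1})\|$. (Note that $x^1=x^0$ since $A_0=0$.) *)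

theory Defs
  imports "HOL-Analysis.Analysis"
begin

definition gradient :: "('a::euclidean_space \<Rightarrow> real) \<Rightarrow> 'a \<Rightarrow> 'a" where
  "gradient f x = (THE D. GDERIV f x :> D)"

lemma gderiv_gradient:
  fixes f :: "'a::euclidean_space \<Rightarrow> real"
  assumes "f differentiable (at x)"
  shows "GDERIV f x :> gradient f x"
proof -
  obtain f' where f': "(f has_derivative f') (at x)"
    using assms unfolding differentiable_def by blast
  then have lin: "linear f'"
    by (rule has_derivative_linear)
  define D where "D = (\<Sum>b\<in>Basis. f' b *\<^sub>R b)"
  have "f' h = h \<bullet> D" for h
  proof -
    have "f' h = f' (\<Sum>b\<in>Basis. (h \<bullet> b) *\<^sub>R b)"
      by (simp add: euclidean_representation)
    also have "\<dots> = (\<Sum>b\<in>Basis. (h \<bullet> b) * f' b)"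
      using lin by (simp add: linear_sum linear_scale)
    finally show ?thesis
      by (simp add: D_def inner_sum_right mult.commute)
  qed
  then have "f' = (\<lambda>h. h \<bullet> D)"
    by blast
  with f' have D: "GDERIV f x :> D"
    by (simp add: gderiv_def)
  have "E = D" if "GDERIV f x :> E" for E
  proof -
    have "(\<lambda>h. h \<bullet> E) = (\<lambda>h. h \<bullet> D)"
      using that D unfolding gderiv_def by (rule has_derivative_unique)
    then have "(E - D) \<bullet> E = (E - D) \<bullet> D"
      by (rule fun_cong)
    then have "(E - D) \<bullet> (E - D) = 0"
      by (simp only: inner_diff_right)
    then show ?thesis
      by simp
  qed
  with D show ?thesis
    unfolding gradient_def by (rule theI)
qed

text \<open>Convexity of a differentiable function, in first-order form; the lemma below shows that for
  differentiable functions it is \<^term>\<open>convex_on UNIV\<close>.\<close>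

definition differentiably_convex :: "('a::euclidean_space \<Rightarrow> real) \<Rightarrow> bool" where
  "differentiably_convex f \<longleftrightarrow> (\<forall>x y. f y \<ge> f x + gradient f x \<bullet> (y - x))"

lemma differentiably_convex_iff_convex_on:
  fixes f :: "'a::euclidean_space \<Rightarrow> real"
  assumes diff: "\<And>x. f differentiable (at x)"
  shows "differentiably_convex f \<longleftrightarrow> convex_on UNIV f"
proof
  assume c: "differentiably_convex f"
  show "convex_on UNIV f"
  proof (rule convex_onI)
    fix t :: real and x y :: 'a
    assume t: "0 < t" "t < 1"
    define w where "w = (1 - t) *\<^sub>R x + t *\<^sub>R y"
    have "(1 - t) * (f w + gradient f w \<bullet> (x - w)) \<le> (1 - t) * f x"
      using c t unfolding differentiably_convex_def by (intro mult_left_mono) auto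
    moreover have "t * (f w + gradient f w \<bullet> (y - w)) \<le> t * f y"
      using c t unfolding differentiably_convex_def by (intro mult_left_mono) auto
    moreover have "(1 - t) * (gradient f w \<bullet> (x - w)) + t * (gradient f w \<bullet> (y - w)) = 0"
    proof -
      have "(1 - t) * (gradient f w \<bullet> (x - w)) + t * (gradient f w \<bullet> (y - w))
          = gradient f w \<bullet> ((1 - t) *\<^sub>R (x - w) + t *\<^sub>R (y - w))"
        by (simp add: inner_add_right)
      also have "(1 - t) *\<^sub>R (x - w) + t *\<^sub>R (y - w) = 0"
        by (simp add: w_def algebra_simps)
      finally show ?thesis
        by simp
    qed
    ultimately have "f w \<le> (1 - t) * f x + t * f y"
      unfolding distrib_left by (simp add: left_diff_distrib)
    then show "f ((1 - t) *\<^sub>R x + t *\<^sub>R y) \<le> (1 - t) * f x + t * f y"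
      by (simp add: w_def)
  qed simp
next
  assume c: "convex_on UNIV f"
  have "f y \<ge> f x + gradient f x \<bullet> (y - x)" for x y
  proof -
    define g where "g = (\<lambda>t::real. f (x + t *\<^sub>R (y - x)))"
    have "convex_on UNIV g"
    proof (rule convex_onI)
      fix t a b :: real
      assume t: "0 < t" "t < 1"
      have "x + ((1 - t) *\<^sub>R a + t *\<^sub>R b) *\<^sub>R (y - x)
          = (1 - t) *\<^sub>R (x + a *\<^sub>R (y - x)) + t *\<^sub>R (x + b *\<^sub>R (y - x))"
        by (simp add: algebra_simps)
      then show "g ((1 - t) *\<^sub>R a + t *\<^sub>R b) \<le> (1 - t) * g a + t * g b"
        unfolding g_def using convex_onD[OF c, of t] t by simp
    qed simp
    moreover have "(g has_real_derivative (gradient f x \<bullet> (y - x))) (at 0)"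
    proof -
      have "(f has_derivative (\<lambda>h. h \<bullet> gradient f x)) (at (x + 0 *\<^sub>R (y - x)))"
        using gderiv_gradient[OF diff, of x] by (simp add: gderiv_def)
      then have "(g has_derivative (\<lambda>s. (s *\<^sub>R (y - x)) \<bullet> gradient f x)) (at 0)"
        unfolding g_def
        by (rule has_derivative_compose[rotated]) (auto intro!: derivative_eq_intros)
      moreover have "(\<lambda>s. (s *\<^sub>R (y - x)) \<bullet> gradient f x) = (*) (gradient f x \<bullet> (y - x))"
        by (rule ext) (simp add: inner_commute[of "y - x"])
      ultimately show ?thesis
        unfolding has_field_derivative_def by simp
    qed
    ultimately have "g 1 - g 0 \<ge> (gradient f x \<bullet> (y - x)) * (1 - 0)"
      by (intro convex_on_imp_above_tangent[where A = UNIV]) auto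
    then show ?thesis
      by (simp add: g_def)
  qed
  then show "differentiably_convex f"
    unfolding differentiably_convex_def by blast
qed

text \<open>The supremum is taken in the extended reals, so that it is \<open>\<infinity>\<close> (and not an unspecified real)
  where the gradient is unbounded on the segment.\<close>

definition sym_L0_L1_smooth :: "real \<Rightarrow> real \<Rightarrow> ('a::euclidean_space \<Rightarrow> real) \<Rightarrow> bool" where
  "sym_L0_L1_smooth L0 L1 f \<longleftrightarrow>
    (\<forall>x y. ereal (norm (gradient f x - gradient f y))
      \<le> (ereal L0 + ereal L1 * (SUP u\<in>closed_segment x y. ereal (norm (gradient f u))))
          * ereal (norm (x - y)))"

text \<open>The predicate holds if the given sequences form a run of the method from \<open>x0\<close>; the values
  \<open>\<alpha> 0\<close> and \<open>G 0\<close> play no role.\<close>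

definition stm_run ::
  "real \<Rightarrow> real \<Rightarrow> ('a::euclidean_space \<Rightarrow> real) \<Rightarrow> real \<Rightarrow> 'a \<Rightarrow> (nat \<Rightarrow> real) \<Rightarrow> (nat \<Rightarrow> real)
    \<Rightarrow> (nat \<Rightarrow> real) \<Rightarrow> (nat \<Rightarrow> 'a) \<Rightarrow> (nat \<Rightarrow> 'a) \<Rightarrow> (nat \<Rightarrow> 'a) \<Rightarrow> bool" where
  "stm_run L0 L1 f \<eta> x0 \<alpha> A G x y z \<longleftrightarrow>
    x 0 = x0 \<and> y 0 = x0 \<and> z 0 = x0 \<and> A 0 = 0 \<and>
    (\<forall>k. \<alpha> (k + 1) = \<eta> * (real k + 2) / 2 \<and>
         A (k + 1) = A k + \<alpha> (k + 1) \<and>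
         x (k + 1) = (A k *\<^sub>R y k + \<alpha> (k + 1) *\<^sub>R z k) /\<^sub>R A (k + 1) \<and>
         G (k + 1) \<ge> L0 + L1 * norm (gradient f (x (k + 1))) \<and>
         z (k + 1) = z k - (\<alpha> (k + 1) / G (k + 1)) *\<^sub>R gradient f (x (k + 1)) \<and>
         y (k + 1) = (A k *\<^sub>R y k + \<alpha> (k + 1) *\<^sub>R z (k + 1)) /\<^sub>R A (k + 1))"

end

theory Submission
  imports Defs
begin

text \<open>Write \<open>\<psi> u = L0 + L1 * norm (\<nabla>f u)\<close>. Iterating the smoothness inequality over a fine partition of
  a segment gives \<open>\<psi> v \<le> \<psi> u * exp (L1 * norm (u - v))\<close>, whence an exponential Lipschitz bound for the
  gradient; convexity turns it into a descent inequality whose quadratic term lacks the usual factor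
  1/2, which is harmless because \<open>\<eta> * exp \<eta> \<le> 1/2\<close>. The classical one-step estimate of the
  similar triangles method, divided by the nondecreasing \<open>G\<close>, then shows that
  \<open>norm (z k - xstar)\<^sup>2 / 2 + A k * (f (y k) - f xstar) / G k\<close> is nonincreasing. Hence all iterates
  stay within distance \<open>norm (x0 - xstar)\<close> of \<open>xstar\<close>, where the Lipschitz bound at \<open>xstar\<close>, at which the
  gradient vanishes, controls \<open>G\<close>.\<close>

section \<open>Gradient bounds, and the smoothness condition over the reals\<close>

lemma gradient_norm_bounded:
  fixes f :: "'a::euclidean_space \<Rightarrow> real"
  assumes diff: "f differentiable_on UNIV" and conv: "differentiably_convex f" and "bounded S"
  obtains B where "\<And>u. u \<in> S \<Longrightarrow> norm (gradient f u) \<le> B"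
proof -
  obtain r where r: "\<And>u. u \<in> S \<Longrightarrow> norm u \<le> r"
    using \<open>bounded S\<close> bounded_iff by blast
  have "continuous_on (cball 0 (r + 1)) f"
    using diff differentiable_imp_continuous_on continuous_on_subset by blast
  then have "bounded (f ` cball 0 (r + 1))"
    using compact_cball compact_continuous_image compact_imp_bounded by blast
  then obtain M where M: "\<And>u. u \<in> cball 0 (r + 1) \<Longrightarrow> \<bar>f u\<bar> \<le> M"
    by (auto simp only: bounded_iff ball_simps real_norm_def)
  show ?thesis
  proof (rule that)
    fix u assume "u \<in> S"
    \<comment> \<open>By convexity \<open>f\<close> grows by at least
      \<open>norm (gradient f u)\<close> along a unit step in the direction of the gradient, so a
      bound of \<open>f\<close> on a ball of radius larger by 1 bounds the gradient.\<close>
    define v where "v = u + sgn (gradient f u)"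
    have "norm v \<le> norm u + norm (sgn (gradient f u))"
      unfolding v_def by (rule norm_triangle_ineq)
    then have "v \<in> cball 0 (r + 1)"
      using r[OF \<open>u \<in> S\<close>] by (simp add: norm_sgn split: if_splits)
    moreover have "u \<in> cball 0 (r + 1)"
      using r[OF \<open>u \<in> S\<close>] by simp
    moreover have "norm (gradient f u) = gradient f u \<bullet> (v - u)"
      by (cases "gradient f u = 0")
        (simp_all add: v_def sgn_div_norm dot_square_norm power2_eq_square)
    moreover have "f v \<ge> f u + gradient f u \<bullet> (v - u)"
      using conv unfolding differentiably_convex_def by blast
    ultimately show "norm (gradient f u) \<le> 2 * M"
      using M[of v] M[of u] by linarith
  qed
qed

lemma gradient_eq_0_at_minimum:
  fixes f :: "'a::euclidean_space \<Rightarrow> real"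
  assumes diff: "f differentiable (at x)" and min: "\<And>y. f x \<le> f y"
  shows "gradient f x = 0"
proof -
  have "(f has_derivative (\<lambda>h. h \<bullet> gradient f x)) (at x)"
    using gderiv_gradient[OF diff] by (simp add: gderiv_def)
  then have "(\<lambda>h. h \<bullet> gradient f x) = (\<lambda>h. 0)"
    using has_derivative_local_min min by (metis always_eventually)
  then have "gradient f x \<bullet> gradient f x = 0"
    by (rule fun_cong)
  then show ?thesis by simp
qed

lemma sym_L0_L1_smoothD:
  fixes f :: "'a::euclidean_space \<Rightarrow> real"
  assumes smooth: "sym_L0_L1_smooth L0 L1 f" and "0 \<le> L1"
    and M: "\<And>u. u \<in> closed_segment x y \<Longrightarrow> L0 + L1 * norm (gradient f u) \<le> M"
  shows "norm (gradient f x - gradient f y) \<le> M * norm (x - y)"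
proof -
  let ?S = "SUP u\<in>closed_segment x y. ereal (norm (gradient f u))"
  have "ereal L0 + ereal L1 * ?S \<le> ereal M"
  \<comment> \<open>For \<open>L1 = 0\<close> the bound \<open>M\<close> says nothing about the
    supremum, but the product with it is \<open>0\<close> even if it is infinite.\<close>
  proof (cases "L1 = 0")
    case True
    then show ?thesis using M[of x] by (simp flip: zero_ereal_def)
  next
    case False
    then have "?S \<le> ereal ((M - L0) / L1)"
      using M \<open>0 \<le> L1\<close> by (intro SUP_least) (simp add: field_simps)
    then have "ereal L1 * ?S \<le> ereal L1 * ereal ((M - L0) / L1)"
      using \<open>0 \<le> L1\<close> by (intro ereal_mult_left_mono) auto
    then have "ereal L0 + ereal L1 * ?S \<le> ereal L0 + ereal (M - L0)"
      using False by (intro add_left_mono) simp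
    then show ?thesis by simp
  qed
  then have "(ereal L0 + ereal L1 * ?S) * ereal (norm (x - y)) \<le> ereal M * ereal (norm (x - y))"
    by (intro ereal_mult_right_mono) auto
  moreover have "ereal (norm (gradient f x - gradient f y))
      \<le> (ereal L0 + ereal L1 * ?S) * ereal (norm (x - y))"
    using smooth unfolding sym_L0_L1_smooth_def by blast
  ultimately have "ereal (norm (gradient f x - gradient f y)) \<le> ereal M * ereal (norm (x - y))"
    by order
  then show ?thesis by simp
qed

section \<open>Growth of the local smoothness, descent, and one step of the method\<close>

context
  fixes f :: "'a::euclidean_space \<Rightarrow> real" and L0 L1 :: real
  assumes diff: "f differentiable_on UNIV"
    and conv: "differentiably_convex f"
    and smooth: "sym_L0_L1_smooth L0 L1 f"
    and L0: "0 < L0" and L1: "0 \<le> L1"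
begin

definition local_smoothness :: "'a \<Rightarrow> real" where
  "local_smoothness u = L0 + L1 * norm (gradient f u)"

lemma local_smoothness_pos: "0 < local_smoothness u"
  using L0 L1 by (simp add: local_smoothness_def add_pos_nonneg)

text \<open>The supremum \<open>M\<close> of \<open>local_smoothness\<close> on the segment
  satisfies \<open>M \<le> local_smoothness x + c * M\<close>. It is finite because the gradient is
  bounded on the segment, so \<open>c * M\<close> can be absorbed on the left.\<close>

lemma local_smoothness_step:
  assumes "L1 * norm (x - y) \<le> c" "c < 1"
  shows "local_smoothness y * (1 - c) \<le> local_smoothness x"
proof -
  obtain B where B: "\<And>u. u \<in> closed_segment x y \<Longrightarrow> norm (gradient f u) \<le> B"
    using gradient_norm_bounded[OF diff conv bounded_closed_segment] by metis
  let ?M = "SUP u\<in>closed_segment x y. local_smoothness u"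
  have "local_smoothness u \<le> L0 + L1 * B" if "u \<in> closed_segment x y" for u
    unfolding local_smoothness_def using B[OF that] L1 by (simp add: mult_left_mono)
  then have bdd: "bdd_above (local_smoothness ` closed_segment x y)"
    by (auto intro!: bdd_aboveI)
  have up: "local_smoothness u \<le> ?M" if "u \<in> closed_segment x y" for u
    by (rule cSUP_upper[OF that bdd])
  have "0 \<le> ?M"
    using up[of x] local_smoothness_pos[of x] by simp
  have "local_smoothness u \<le> local_smoothness x + c * ?M" if u: "u \<in> closed_segment x y" for u
  proof -
    \<comment> \<open>Smoothness is applied between \<open>x\<close> and \<open>u\<close> only; the
      supremum over the full segment still dominates there.\<close>
    have sub: "closed_segment x u \<subseteq> closed_segment x y"
      using u by (simp add: subset_closed_segment)
    have "norm (gradient f x - gradient f u) \<le> ?M * norm (x - u)"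
      using up sub by (intro sym_L0_L1_smoothD[OF smooth L1]) (auto simp: local_smoothness_def)
    then have "norm (gradient f u) \<le> norm (gradient f x) + ?M * norm (x - u)"
      using norm_triangle_ineq2[of "gradient f u" "gradient f x"] by (simp add: norm_minus_commute)
    then have "L1 * norm (gradient f u) \<le> L1 * (norm (gradient f x) + ?M * norm (x - u))"
      using L1 by (rule mult_left_mono)
    moreover have "norm (x - u) \<le> norm (x - y)"
      using segment_bound(1)[OF u] by (simp add: norm_minus_commute)
    then have "(L1 * norm (x - u)) * ?M \<le> c * ?M"
      using assms \<open>0 \<le> ?M\<close> L1 by (meson mult_left_mono mult_right_mono order_trans)
    ultimately show ?thesis
      by (simp add: local_smoothness_def algebra_simps)
  qed
  then have "?M \<le> local_smoothness x + c * ?M"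
    by (intro cSUP_least) auto
  then have "?M * (1 - c) \<le> local_smoothness x"
    by (simp add: algebra_simps)
  moreover have "local_smoothness y * (1 - c) \<le> ?M * (1 - c)"
    using up[of y] assms by (intro mult_right_mono) auto
  ultimately show ?thesis by linarith
qed

lemma local_smoothness_exp_le:
  "local_smoothness y \<le> local_smoothness x * exp (L1 * norm (x - y))"
proof -
  let ?d = "L1 * norm (x - y)"
  \<comment> \<open>The segment is cut into \<open>n\<close> equal pieces, each costing a factor
    \<open>1 - d / n\<close>, which \<open>d < n\<close> keeps positive. The form
    \<open>1 + - d / n\<close> matches the limit defining \<open>exp (- d)\<close>.\<close>
  have partition: "local_smoothness y * (1 + - ?d / real n) ^ n \<le> local_smoothness x"
    if n: "?d < real n" for n
  proof -
    have "0 < n" using n L1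
      by (metis gr_zeroI mult_nonneg_nonneg norm_ge_zero not_less of_nat_0)
    let ?c = "?d / real n" and ?w = "\<lambda>i. x + (real i / real n) *\<^sub>R (y - x)"
    have c: "?c < 1" using n \<open>0 < n\<close> by simp
    have "local_smoothness (?w i) * (1 - ?c) ^ i \<le> local_smoothness x" for i
    proof (induction i)
      case (Suc i)
      have "?w i - ?w (Suc i) = (1 / real n) *\<^sub>R (x - y)"
        using \<open>0 < n\<close> by (simp add: field_simps flip: scaleR_left_distrib scaleR_minus_right)
          (simp add: algebra_simps add_divide_distrib)
      then have "L1 * norm (?w i - ?w (Suc i)) \<le> ?c"
        by simp
      from local_smoothness_step[OF this c]
      have "local_smoothness (?w (Suc i)) * (1 - ?c) * (1 - ?c) ^ i
          \<le> local_smoothness (?w i) * (1 - ?c) ^ i"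
        using c by (intro mult_right_mono) auto
      with Suc show ?case by (simp add: mult.assoc)
    qed simp
    from this[of n] show ?thesis using \<open>0 < n\<close> by simp
  qed
  have "(\<lambda>n. (1 + - ?d / real n) ^ n) \<longlonglongrightarrow> exp (- ?d)"
    by (rule tendsto_exp_limit_sequentially)
  then have "(\<lambda>n. local_smoothness y * (1 + - ?d / real n) ^ n)
      \<longlonglongrightarrow> local_smoothness y * exp (- ?d)"
    by (rule tendsto_mult_left)
  moreover have "\<forall>\<^sub>F n in sequentially. ?d < real n"
    using filterlim_real_sequentially by (simp add: filterlim_at_top_dense)
  then have "\<forall>\<^sub>F n in sequentially.
      local_smoothness y * (1 + - ?d / real n) ^ n \<le> local_smoothness x"
    by (rule eventually_mono) (rule partition)
  ultimately have "local_smoothness y * exp (- ?d) \<le> local_smoothness x"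
    by (intro tendsto_upperbound) auto
  then show ?thesis
    by (simp add: exp_minus field_simps)
qed

text \<open>No \<open>u\<close> on the segment is farther from \<open>x\<close> than
  \<open>y\<close> is, so the exponential bound centred at \<open>x\<close> controls the whole
  segment. Only the gradient at \<open>x\<close> enters; later \<open>x\<close> is the base point of
  a gradient step, or \<open>xstar\<close>.\<close>

lemma gradient_diff_le:
  "norm (gradient f x - gradient f y)
    \<le> local_smoothness x * exp (L1 * norm (x - y)) * norm (x - y)"
proof (rule sym_L0_L1_smoothD[OF smooth L1])
  fix u assume "u \<in> closed_segment x y"
  then have "norm (x - u) \<le> norm (x - y)"
    using segment_bound(1) by (metis norm_minus_commute)
  then have "local_smoothness x * exp (L1 * norm (x - u))
      \<le> local_smoothness x * exp (L1 * norm (x - y))"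
    using L1 local_smoothness_pos[of x] by (intro mult_left_mono) (auto intro: mult_left_mono)
  then show "L0 + L1 * norm (gradient f u) \<le> local_smoothness x * exp (L1 * norm (x - y))"
    using local_smoothness_exp_le[of u x] by (simp add: local_smoothness_def)
qed

lemma descent:
  "f y \<le> f x + gradient f x \<bullet> (y - x)
    + local_smoothness x * exp (L1 * norm (x - y)) * (norm (x - y))\<^sup>2"
proof -
  \<comment> \<open>The tangent at \<open>y\<close> bounds \<open>f y\<close> from above. Exchanging
    its gradient for that at \<open>x\<close> costs an inner product of the gradient difference,
    left to Cauchy-Schwarz.\<close>
  have "f x \<ge> f y + gradient f y \<bullet> (x - y)"
    using conv unfolding differentiably_convex_def by blast
  then have "f y \<le> f x + gradient f x \<bullet> (y - x) + (gradient f x - gradient f y) \<bullet> (x - y)"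
    by (simp add: inner_diff_left inner_diff_right)
  moreover have "(gradient f x - gradient f y) \<bullet> (x - y)
      \<le> norm (gradient f x - gradient f y) * norm (x - y)"
    by (rule norm_cauchy_schwarz)
  moreover have "\<dots> \<le> local_smoothness x * exp (L1 * norm (x - y)) * norm (x - y) * norm (x - y)"
    by (intro mult_right_mono gradient_diff_le) simp
  ultimately show ?thesis
    by (simp add: power2_eq_square mult.assoc)
qed

text \<open>The step has length \<open>c * norm (gradient f x) / G\<close>, and
  \<open>L1 * norm (gradient f x) \<le> G\<close>, so the exponent in \<open>descent\<close> is at
  most \<open>\<eta>\<close>. The quadratic term then eats at most half of the linear gain.\<close>

lemma gradient_step_decrease:
  assumes G: "local_smoothness x \<le> G" and c: "0 \<le> c" "c \<le> \<eta>" and \<eta>: "\<eta> * exp \<eta> \<le> 1 / 2"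
  shows "f (x - (c / G) *\<^sub>R gradient f x) \<le> f x - c * (norm (gradient f x))\<^sup>2 / (2 * G)"
proof -
  let ?g = "norm (gradient f x)" and ?y = "x - (c / G) *\<^sub>R gradient f x"
  have "0 < G"
    using G local_smoothness_pos[of x] by simp
  have d: "norm (x - ?y) = c * ?g / G"
    using c \<open>0 < G\<close> by simp
  have "L1 * ?g \<le> G"
    using G L0 by (simp add: local_smoothness_def)
  then have "c * (L1 * ?g) \<le> \<eta> * G"
    using c L1 \<open>0 < G\<close> by (intro mult_mono) auto
  then have "exp (L1 * norm (x - ?y)) \<le> exp \<eta>"
    unfolding d using \<open>0 < G\<close> by (simp add: field_simps)
  then have "local_smoothness x * exp (L1 * norm (x - ?y)) * (norm (x - ?y))\<^sup>2
      \<le> G * exp \<eta> * (norm (x - ?y))\<^sup>2"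
    using G \<open>0 < G\<close> by (intro mult_right_mono mult_mono) auto
  also have "\<dots> = (c * exp \<eta>) * (c * ?g\<^sup>2 / G)"
    unfolding d using \<open>0 < G\<close> by (simp add: field_simps power2_eq_square)
  also have "\<dots> \<le> 1 / 2 * (c * ?g\<^sup>2 / G)"
  proof (intro mult_right_mono)
    have "c * exp \<eta> \<le> \<eta> * exp \<eta>"
      using c by (intro mult_right_mono) auto
    then show "c * exp \<eta> \<le> 1 / 2" using \<eta> by linarith
  qed (use c \<open>0 < G\<close> in auto)
  finally have "f ?y \<le> f x + gradient f x \<bullet> (?y - x) + 1 / 2 * (c * ?g\<^sup>2 / G)"
    using descent[of ?y x] by linarith
  moreover have "gradient f x \<bullet> (?y - x) = - (c * ?g\<^sup>2 / G)"
    by (simp add: power2_norm_eq_inner)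
  moreover have "c * ?g\<^sup>2 / (2 * G) = 1 / 2 * (c * ?g\<^sup>2 / G)"
    by simp
  ultimately show ?thesis
    by linarith
qed

text \<open>Since \<open>y' - x\<close> is a multiple of \<open>z' - z\<close>, the point
  \<open>y'\<close> is a gradient step from \<open>x\<close>. Its decrease, weighted by
  \<open>A + a\<close>, cancels exactly the squared gradient in the expansion of
  \<open>norm (z' - w)\<close>.\<close>

lemma similar_triangles_step:
  assumes "0 \<le> A" "0 < a" and a: "a\<^sup>2 \<le> \<eta> * (A + a)" and \<eta>: "\<eta> * exp \<eta> \<le> 1 / 2"
    and x: "x = (A *\<^sub>R y + a *\<^sub>R z) /\<^sub>R (A + a)"
    and G: "local_smoothness x \<le> G"
    and z': "z' = z - (a / G) *\<^sub>R gradient f x"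
    and y': "y' = (A *\<^sub>R y + a *\<^sub>R z') /\<^sub>R (A + a)"
  shows "G / 2 * (norm (z' - w))\<^sup>2 + (A + a) * (f y' - f w)
    \<le> G / 2 * (norm (z - w))\<^sup>2 + A * (f y - f w)"
proof -
  let ?g = "gradient f x"
  have "0 < G"
    using G local_smoothness_pos[of x] by simp
  have Aa: "0 < A + a" using assms by simp
  have Ax: "(A + a) *\<^sub>R x = A *\<^sub>R y + a *\<^sub>R z"
    using Aa x by simp
  \<comment> \<open>The step length of \<open>y'\<close> is \<open>c / G\<close>; the hypothesis on
    \<open>a\<close> says precisely \<open>c \<le> \<eta>\<close>.\<close>
  define c where "c = a\<^sup>2 / (A + a)"
  have cA: "(A + a) * c = a\<^sup>2"
    using Aa by (simp add: c_def)
  have c: "0 \<le> c" "c \<le> \<eta>"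
    using a Aa by (auto simp: c_def field_simps)
  have "y' = x - (c / G) *\<^sub>R ?g"
    unfolding y' z' using x
    by (simp add: c_def scaleR_diff_right scaleR_add_right power2_eq_square divide_inverse mult.assoc
        mult.commute mult.left_commute)
  then have "f y' \<le> f x - c * (norm ?g)\<^sup>2 / (2 * G)"
    using gradient_step_decrease[OF G c \<eta>] by simp
  then have "(A + a) * f y' \<le> (A + a) * (f x - c * (norm ?g)\<^sup>2 / (2 * G))"
    using Aa by (intro mult_left_mono) auto
  also have "\<dots> = (A + a) * f x - ((A + a) * c) * (norm ?g)\<^sup>2 / (2 * G)"
    by (simp add: right_diff_distrib)
  finally have fy': "(A + a) * f y' \<le> (A + a) * f x - a\<^sup>2 * (norm ?g)\<^sup>2 / (2 * G)"
    unfolding cA .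
  have "f w \<ge> f x + ?g \<bullet> (w - x)" "f y \<ge> f x + ?g \<bullet> (y - x)"
    using conv unfolding differentiably_convex_def by blast+
  then have "a * (f x + ?g \<bullet> (w - x)) \<le> a * f w" "A * (f x + ?g \<bullet> (y - x)) \<le> A * f y"
    using assms(1,2) by (auto intro: mult_left_mono)
  \<comment> \<open>As \<open>x\<close> is the weighted mean of \<open>y\<close> and
    \<open>z\<close>, the two tangent terms merge into the cross term of the expansion of
    \<open>norm (z' - w)\<close>.\<close>
  moreover have "a * (?g \<bullet> (w - x)) + A * (?g \<bullet> (y - x)) = a * (?g \<bullet> (w - z))"
  proof -
    have "a *\<^sub>R (w - x) + A *\<^sub>R (y - x) = a *\<^sub>R (w - z)"
      using Ax by (simp add: algebra_simps)
    then have "?g \<bullet> (a *\<^sub>R (w - x) + A *\<^sub>R (y - x)) = ?g \<bullet> (a *\<^sub>R (w - z))" by (rule arg_cong)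
    then show ?thesis by (simp only: inner_add_right inner_scaleR_right)
  qed
  ultimately have lower: "(A + a) * f x + a * (?g \<bullet> (w - z)) \<le> a * f w + A * f y"
    by (simp add: algebra_simps)
  have z'w: "z' - w = (z - w) - (a / G) *\<^sub>R ?g"
    unfolding z' by simp
  have "(norm (z' - w))\<^sup>2
      = (norm (z - w))\<^sup>2 + 2 * (a / G) * (?g \<bullet> (w - z)) + (a / G)\<^sup>2 * (norm ?g)\<^sup>2"
    unfolding z'w power2_norm_eq_inner
    by (simp add: inner_diff_left inner_diff_right inner_commute algebra_simps power2_eq_square)
  then have "G / 2 * (norm (z' - w))\<^sup>2
      = G / 2 * (norm (z - w))\<^sup>2 + a * (?g \<bullet> (w - z)) + a\<^sup>2 * (norm ?g)\<^sup>2 / (2 * G)"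
    using \<open>0 < G\<close> by (simp add: field_simps power2_eq_square)
  with fy' lower show ?thesis
    by (simp add: algebra_simps)
qed

end

section \<open>Convergence rate along a run of the method\<close>

theorem theorem5p2:
  fixes f :: "real ^ 'd \<Rightarrow> real"
    and L0 L1 \<nu> \<eta> :: real
    and xstar x0 :: "real ^ 'd"
    and \<alpha> A G :: "nat \<Rightarrow> real"
    and x y z :: "nat \<Rightarrow> real ^ 'd"
  assumes "f differentiable_on UNIV"
    and "differentiably_convex f"
    and "sym_L0_L1_smooth L0 L1 f"
    and "L0 > 0" and "L1 \<ge> 0"
    and "is_arg_min f (\<lambda>_. True) xstar"
    and "\<nu> = exp (- \<nu>)"
    and "0 < \<eta>" and "\<eta> \<le> \<nu> / 2"
    and "stm_run L0 L1 f \<eta> x0 \<alpha> A G x y z"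
    and "G 1 = L0 + L1 * norm (gradient f x0)"
    and "\<forall>k\<ge>1. G (k + 1) = max (G k) (L0 + L1 * norm (gradient f (x (k + 1))))"
  shows "\<forall>N\<ge>1. f (y N) - f xstar
    \<le> 2 * L0 * (1 + L1 * norm (x0 - xstar) * exp (L1 * norm (x0 - xstar))) * (norm (x0 - xstar))\<^sup>2
        / (\<eta> * real N * (real N + 3))"
proof -
  note ctx = assms(1-5)
  let ?R = "norm (x0 - xstar)"
  let ?H = "L0 * (1 + L1 * ?R * exp (L1 * ?R))"
  have min: "f xstar \<le> f u" for u
    using assms(6) by (simp add: is_arg_min_def not_less)
  have grad0: "gradient f xstar = 0"
    using assms(1) min by (intro gradient_eq_0_at_minimum) (simp_all add: differentiable_on_def)
  have run: "x 0 = x0" "y 0 = x0" "z 0 = x0" "A 0 = 0"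
    "\<alpha> (Suc k) = \<eta> * (real k + 2) / 2"
    "A (Suc k) = A k + \<alpha> (Suc k)"
    "x (Suc k) = (A k *\<^sub>R y k + \<alpha> (Suc k) *\<^sub>R z k) /\<^sub>R A (Suc k)"
    "G (Suc k) \<ge> L0 + L1 * norm (gradient f (x (Suc k)))"
    "z (Suc k) = z k - (\<alpha> (Suc k) / G (Suc k)) *\<^sub>R gradient f (x (Suc k))"
    "y (Suc k) = (A k *\<^sub>R y k + \<alpha> (Suc k) *\<^sub>R z (Suc k)) /\<^sub>R A (Suc k)" for k
    using assms(10) unfolding stm_run_def Suc_eq_plus1 by blast+
  have \<alpha>: "0 < \<alpha> (Suc k)" for k
    unfolding run(5) using assms(8) by (simp add: add_nonneg_pos)
  \<comment> \<open>Summing the arithmetic progression of the \<open>\<alpha>\<close>; this is the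
    source of \<open>N * (N + 3)\<close> in the rate.\<close>
  have A: "A k = \<eta> * real k * (real k + 3) / 4" for k
    by (induction k) (simp_all add: run(4,5,6) field_simps)
  have A0: "0 \<le> A k" for k
    unfolding A using assms(8) by simp
  have A_pos: "0 < A (Suc k)" for k
    using A0[of k] \<alpha>[of k] run(6) by simp
  have G_pos: "0 < G (Suc k)" for k
    using run(8)[of k] assms(4,5) by (smt (verit) mult_nonneg_nonneg norm_ge_zero)
  \<comment> \<open>The equation for \<open>\<nu>\<close> means
    \<open>\<nu> * exp \<nu> = 1\<close>, and \<open>\<eta>\<close> is at most
    \<open>\<nu> / 2\<close>.\<close>
  have \<eta>: "\<eta> * exp \<eta> \<le> 1 / 2"
  proof -
    have "0 < \<nu>" using assms(7) by (metis exp_gt_zero)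
    have "\<eta> * exp \<eta> \<le> \<nu> / 2 * exp \<nu>"
      using assms(8,9) \<open>0 < \<nu>\<close> by (intro mult_mono) auto
    also have "\<nu> * exp \<nu> = exp (- \<nu>) * exp \<nu>"
      using assms(7) by simp
    then have "\<nu> / 2 * exp \<nu> = 1 / 2"
      by (simp flip: exp_add)
    finally show ?thesis .
  qed
  have \<alpha>_sq: "(\<alpha> (Suc k))\<^sup>2 \<le> \<eta> * (A k + \<alpha> (Suc k))" for k
  proof -
    have "\<eta> * (A k + \<alpha> (Suc k)) - (\<alpha> (Suc k))\<^sup>2 = \<eta>\<^sup>2 * real k / 4"
      unfolding A run(5) by (simp add: field_simps power2_eq_square)
    moreover have "0 \<le> \<eta>\<^sup>2 * real k / 4" by simp
    ultimately show ?thesis by linarith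
  qed
  have G_mono: "G (Suc k) \<le> G (Suc (Suc k))" for k
    using assms(12) by (simp add: le_max_iff_disj)
  have step: "G (Suc k) / 2 * (norm (z (Suc k) - xstar))\<^sup>2 + A (Suc k) * (f (y (Suc k)) - f xstar)
      \<le> G (Suc k) / 2 * (norm (z k - xstar))\<^sup>2 + A k * (f (y k) - f xstar)" for k
    using similar_triangles_step[OF ctx A0 \<alpha> \<alpha>_sq \<eta>, of _ _ _ _ _ _ _ xstar]
      run(6-10)[of k] local_smoothness_def[OF ctx] by metis
  \<comment> \<open>The index starts at \<open>Suc k\<close> because the sign of \<open>G 0\<close>
    is unknown; \<open>A 0 = 0\<close> makes the initial value
    \<open>?R\<^sup>2 / 2\<close>.\<close>
  have potential: "(norm (z (Suc k) - xstar))\<^sup>2 / 2 + A (Suc k) * (f (y (Suc k)) - f xstar) / G (Suc k)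
      \<le> ?R\<^sup>2 / 2" for k
  proof (induction k)
    case 0
    show ?case
      using step[of 0] G_pos[of 0] by (simp add: run(2-4) field_simps)
  next
    case (Suc k)
    let ?d = "A (Suc k) * (f (y (Suc k)) - f xstar)"
    \<comment> \<open>Enlarging \<open>G\<close> before the next step can only lower the potential,
      as \<open>?d\<close> is nonnegative.\<close>
    have "?d / G (Suc (Suc k)) \<le> ?d / G (Suc k)"
      using A0 min G_pos G_mono by (intro divide_left_mono mult_nonneg_nonneg mult_pos_pos) auto
    moreover have "(norm (z (Suc (Suc k)) - xstar))\<^sup>2 / 2
        + A (Suc (Suc k)) * (f (y (Suc (Suc k))) - f xstar) / G (Suc (Suc k))
        \<le> (norm (z (Suc k) - xstar))\<^sup>2 / 2 + ?d / G (Suc (Suc k))"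
      using divide_right_mono[OF step less_imp_le[OF G_pos], of "Suc k" "Suc k"] G_pos[of "Suc k"]
      by (simp add: add_divide_distrib)
    ultimately show ?case using Suc by linarith
  qed
  have z_dist: "norm (z k - xstar) \<le> ?R" for k
  proof (cases k)
    case (Suc j)
    have "0 \<le> A k * (f (y k) - f xstar) / G k"
      using A0 min G_pos Suc by (intro divide_nonneg_nonneg mult_nonneg_nonneg) (auto intro: less_imp_le)
    then have "(norm (z k - xstar))\<^sup>2 \<le> ?R\<^sup>2"
      using potential[of j] unfolding Suc by linarith
    then show ?thesis by (rule power2_le_imp_le) simp
  qed (simp add: run)
  \<comment> \<open>The weights sum to 1, so convexity of the ball around \<open>xstar\<close>
    passes the bound from \<open>z\<close> to \<open>y\<close>, and from both to
    \<open>x\<close>.\<close>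
  have combination: "norm ((A k *\<^sub>R u + \<alpha> (Suc k) *\<^sub>R v) /\<^sub>R A (Suc k) - xstar) \<le> ?R"
    if "norm (u - xstar) \<le> ?R" "norm (v - xstar) \<le> ?R" for k u v
  proof -
    let ?s = "A k / A (Suc k)" and ?t = "\<alpha> (Suc k) / A (Suc k)"
    have "?s *\<^sub>R u + ?t *\<^sub>R v \<in> cball xstar ?R"
      using that A0[of k] \<alpha>[of k] A_pos[of k] run(6)[of k]
      by (intro convexD[OF convex_cball])
        (auto simp: dist_norm norm_minus_commute simp flip: add_divide_distrib)
    moreover have "(A k *\<^sub>R u + \<alpha> (Suc k) *\<^sub>R v) /\<^sub>R A (Suc k) = ?s *\<^sub>R u + ?t *\<^sub>R v"
      by (simp add: scaleR_add_right divide_inverse_commute)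
    ultimately show ?thesis
      by (simp add: dist_norm norm_minus_commute)
  qed
  have y_dist: "norm (y k - xstar) \<le> ?R" for k
    by (induction k) (simp_all add: run(2,10) combination z_dist)
  have x_dist: "norm (x k - xstar) \<le> ?R" for k
    by (cases k) (simp_all add: run(1,7) combination y_dist z_dist)
  \<comment> \<open>At \<open>xstar\<close> the local smoothness is just \<open>L0\<close>, so the
    bound involves only \<open>L0\<close>, \<open>L1\<close> and \<open>?R\<close>.\<close>
  have H: "L0 + L1 * norm (gradient f u) \<le> ?H" if u: "norm (u - xstar) \<le> ?R" for u
  proof -
    have "norm (gradient f u) \<le> L0 * exp (L1 * norm (u - xstar)) * norm (u - xstar)"
      using gradient_diff_le[OF ctx, of xstar u]
      by (simp add: grad0 local_smoothness_def[OF ctx] norm_minus_commute)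
    also have "\<dots> \<le> L0 * exp (L1 * ?R) * ?R"
      using u assms(4,5) by (intro mult_mono) (auto intro: mult_left_mono)
    finally have "L1 * norm (gradient f u) \<le> L1 * (L0 * exp (L1 * ?R) * ?R)"
      using assms(5) by (rule mult_left_mono)
    then show ?thesis by (simp add: algebra_simps)
  qed
  have G_le: "G (Suc k) \<le> ?H" for k
  proof (induction k)
    case 0
    \<comment> \<open>With \<open>A 0 = 0\<close> the first average is \<open>z 0\<close>, so the
      prescribed \<open>G 1\<close> is the local smoothness at \<open>x 1\<close>.\<close>
    have "x (Suc 0) = x0"
      using run(6)[of 0] \<alpha>[of 0] by (simp add: run(1-4,7))
    then show ?case
      using H[OF x_dist, of 1] assms(11) by simp
  next
    case (Suc k)
    have "G (Suc (Suc k)) = max (G (Suc k)) (L0 + L1 * norm (gradient f (x (Suc (Suc k)))))"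
      using assms(12)[rule_format, of "Suc k"] by simp
    with Suc H[OF x_dist] show ?case by simp
  qed
  show ?thesis
  proof (intro allI impI)
    fix N :: nat assume "1 \<le> N"
    then obtain k where N: "N = Suc k" by (cases N) auto
    have "A N * (f (y N) - f xstar) / G N \<le> ?R\<^sup>2 / 2"
      using potential[of k] zero_le_power2[of "norm (z N - xstar)"] unfolding N by linarith
    then have "A N * (f (y N) - f xstar) \<le> G N * ?R\<^sup>2 / 2"
      using G_pos[of k] N by (simp add: field_simps)
    also have "\<dots> \<le> ?H * ?R\<^sup>2 / 2"
      using G_le[of k] N by (intro divide_right_mono mult_right_mono) auto
    \<comment> \<open>The \<open>1 / 2\<close> here and the \<open>1 / 4\<close> in
      \<open>A N\<close> combine to the factor 2 of the rate.\<close>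
    finally have "f (y N) - f xstar \<le> (?H * ?R\<^sup>2 / 2) / A N"
      using A_pos[of k] N by (simp add: pos_le_divide_eq mult_ac)
    also have "\<dots> = 2 * ?H * ?R\<^sup>2 / (\<eta> * real N * (real N + 3))"
      unfolding A by simp
    finally show "f (y N) - f xstar
        \<le> 2 * L0 * (1 + L1 * ?R * exp (L1 * ?R)) * ?R\<^sup>2 / (\<eta> * real N * (real N + 3))"
      by (simp only: mult.assoc)
  qed
qed

end
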